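(* Let $p:\mathbb{R}^n \to \mathbb{R}$ be a function. Then $p$ is positively homogeneous and continuous on $\mathbb{R}^n$ if and only if there exist index sets $I$ and $S$ and a two-index family of vectors $\{a_{is} \in \mathbb{R}^n \,|\, i \in I,\ s \in S\}$ such that, for each $x \in \mathbb{R}^n$, $$-\infty < \inf_{i \in I}\langle a_{is}, x \rangle \quad \forall\, s \in S \qquad\text{and}\qquad \sup_{s \in S}\langle a_{is}, x \rangle < +\infty \quad \forall\, i \in I,$$ and $$p(x) = \inf_{i \in I}\sup_{s \in S}\langle a_{is}, x \rangle = \sup_{s \in S}\inf_{i \in I}\langle a_{is}, x \rangle \quad \forall\, x \in \mathbb{R}^n.$$
   Context: A function $p:\mathbb{R}^n\to\mathbb{R}$ is positively homogeneous if $p(\lambda x)=\lambda p(x)$ for all $x\in\mathbb{R}^n$ and all real $\lambda>0$. $\langle\cdot,\cdot\rangle$ denotes the standard inner product on $\mathbb{R}^n$. The index sets $I$ and $S$ are arbitrary (possibly infinite). Infima and suprema are taken in the extended reals. *)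

theory Defs
  imports "HOL-Analysis.Analysis"
begin

definition positively_homogeneous :: "('a::real_vector \<Rightarrow> real) \<Rightarrow> bool" where
  "positively_homogeneous p \<longleftrightarrow> (\<forall>x. \<forall>c>0. p (c *\<^sub>R x) = c * p x)"

(* The bounds INF and SUP are taken in the complete lattice ereal. The index sets are not required
   to be nonempty: an empty one makes one of the two iterated bounds infinite, which the equations
   with the finite value p x exclude. *)
definition inf_sup_representation ::
  "(real ^ 'n \<Rightarrow> real) \<Rightarrow> 'i set \<Rightarrow> 's set \<Rightarrow> ('i \<Rightarrow> 's \<Rightarrow> real ^ 'n) \<Rightarrow> bool" where
  "inf_sup_representation p I S a \<longleftrightarrow>
     (\<forall>x. (\<forall>s\<in>S. -\<infinity> < (INF i\<in>I. ereal (a i s \<bullet> x))) \<and>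
          (\<forall>i\<in>I. (SUP s\<in>S. ereal (a i s \<bullet> x)) < \<infinity>)) \<and>
     (\<forall>x. ereal (p x) = (INF i\<in>I. SUP s\<in>S. ereal (a i s \<bullet> x)) \<and>
          ereal (p x) = (SUP s\<in>S. INF i\<in>I. ereal (a i s \<bullet> x)))"

end

theory Submission
  imports Defs
begin

text \<open>
  Sufficiency. For a fixed \<open>i\<close> the function \<open>\<phi>\<^sub>i x = (SUP s\<in>S. a i s \<bullet> x)\<close> is finite and sublinear,
  hence convex and therefore continuous. So \<open>p\<close>, being the infimum of the \<open>\<phi>\<^sub>i\<close>, is positively
  homogeneous and upper semicontinuous. Negating \<open>p\<close> and all vectors exchanges the two iterated
  bounds, so \<open>- p\<close> is upper semicontinuous as well, and \<open>p\<close> is continuous.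

  Necessity. Let \<open>I\<close> consist of the majorants of \<open>p\<close> of the special form \<open>b \<bullet> x + C * norm x\<close> with
  \<open>C \<ge> 0\<close>, and \<open>S\<close> of the minorants \<open>d \<bullet> x - D * norm x\<close> with \<open>D \<ge> 0\<close>. If \<open>\<psi> \<in> S\<close> lies below
  \<open>\<phi> \<in> I\<close>, then the balls of radius \<open>C\<close> about \<open>b\<close> and of radius \<open>D\<close> about \<open>d\<close> meet, and any common
  point \<open>v\<close> satisfies \<open>\<psi> x \<le> v \<bullet> x \<le> \<phi> x\<close> for all \<open>x\<close>. Take such a vector as the member of the family with indices \<open>\<phi>\<close>, \<open>\<psi>\<close>. Then
  \<open>SUP \<psi> \<le> SUP INF \<le> INF SUP \<le> INF \<phi>\<close> at every point, where the middle inequality always holds.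
  The chain collapses to \<open>p\<close> because the special majorants approximate \<open>p\<close> from above at every
  point, and, by the same fact for \<open>- p\<close>, the special minorants do so from below.
\<close>

section \<open>Infima of suprema of linear functions\<close>

text \<open>The inner suprema are finite: bounded above by hypothesis, and over a nonempty set because an
  empty \<open>S\<close> would make the right-hand side infinite. As suprema of linear functions they are then
  real-valued, convex and positively subhomogeneous. Passing to them removes all arithmetic with
  infinite values from the arguments about \<open>p\<close>.\<close>

lemma real_sup_family:
  fixes p :: "'a::euclidean_space \<Rightarrow> real" and a :: "'i \<Rightarrow> 's \<Rightarrow> 'a"
  assumes fin: "\<And>x i. i \<in> I \<Longrightarrow> (SUP s\<in>S. ereal (a i s \<bullet> x)) < \<infinity>"
    and p: "\<And>x. ereal (p x) = (INF i\<in>I. SUP s\<in>S. ereal (a i s \<bullet> x))"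
  obtains \<phi> :: "'i \<Rightarrow> 'a \<Rightarrow> real" where
    "\<And>i. i \<in> I \<Longrightarrow> convex_on UNIV (\<phi> i)"
    "\<And>i c x. i \<in> I \<Longrightarrow> 0 < c \<Longrightarrow> \<phi> i (c *\<^sub>R x) \<le> c * \<phi> i x"
    "\<And>i x. i \<in> I \<Longrightarrow> p x \<le> \<phi> i x"
    "\<And>x r. p x < r \<Longrightarrow> \<exists>i\<in>I. \<phi> i x < r"
proof -
  have S: "S \<noteq> {}"
  proof
    assume "S = {}"
    then have "ereal (p 0) = (INF i\<in>I. (- \<infinity>))" using p[of 0] by (simp add: bot_ereal_def)
    then show False by (cases "I = {}") (auto simp: top_ereal_def)
  qed
  define \<phi> where "\<phi> = (\<lambda>i x. SUP s\<in>S. a i s \<bullet> x)"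
  have eq: "ereal (\<phi> i x) = (SUP s\<in>S. ereal (a i s \<bullet> x))" if "i \<in> I" for i x
  proof -
    obtain s where "s \<in> S" using S by blast
    then have "ereal (a i s \<bullet> x) \<le> (SUP s\<in>S. ereal (a i s \<bullet> x))" by (intro SUP_upper)
    then have "\<bar>SUP s\<in>S. ereal (a i s \<bullet> x)\<bar> \<noteq> \<infinity>"
      using fin[OF that, of x] by auto
    then show ?thesis unfolding \<phi>_def by (rule ereal_SUP)
  qed
  have upper: "a i s \<bullet> x \<le> \<phi> i x" if "i \<in> I" "s \<in> S" for i s x
    using SUP_upper[OF that(2), of "\<lambda>s. ereal (a i s \<bullet> x)"] eq[OF that(1), of x]
    by (metis ereal_less_eq(3))
  have least: "\<phi> i x \<le> r" if "\<And>s. s \<in> S \<Longrightarrow> a i s \<bullet> x \<le> r" for i x r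
    unfolding \<phi>_def using S that by (rule cSUP_least)
  show thesis
  proof
    fix i assume i: "i \<in> I"
    show "convex_on UNIV (\<phi> i)"
    proof (rule convex_onI)
      fix t :: real and x y :: 'a
      assume t: "0 < t" "t < 1"
      show "\<phi> i ((1 - t) *\<^sub>R x + t *\<^sub>R y) \<le> (1 - t) * \<phi> i x + t * \<phi> i y"
        using t upper[OF i]
        by (intro least) (simp add: inner_add_right add_mono mult_left_mono)
    qed simp
    show "\<phi> i (c *\<^sub>R x) \<le> c * \<phi> i x" if "0 < c" for c x
      using that upper[OF i] by (intro least) (simp add: mult_left_mono)
    show "p x \<le> \<phi> i x" for x
      using INF_lower[OF i, of "\<lambda>i. SUP s\<in>S. ereal (a i s \<bullet> x)"] p[of x] eq[OF i, of x]
      by (metis ereal_less_eq(3))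
  next
    fix x r assume "p x < r"
    then have "(INF i\<in>I. SUP s\<in>S. ereal (a i s \<bullet> x)) < ereal r"
      by (simp flip: p)
    then obtain i where "i \<in> I" "(SUP s\<in>S. ereal (a i s \<bullet> x)) < ereal r"
      by (auto simp: INF_less_iff)
    then show "\<exists>i\<in>I. \<phi> i x < r"
      using eq by (metis less_ereal.simps(1))
  qed
qed

lemma inf_sup_open_sublevel:
  fixes p :: "'a::euclidean_space \<Rightarrow> real" and a :: "'i \<Rightarrow> 's \<Rightarrow> 'a"
  assumes fin: "\<And>x i. i \<in> I \<Longrightarrow> (SUP s\<in>S. ereal (a i s \<bullet> x)) < \<infinity>"
    and p: "\<And>x. ereal (p x) = (INF i\<in>I. SUP s\<in>S. ereal (a i s \<bullet> x))"
  shows "open {x. p x < r}"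
proof -
  obtain \<phi> where \<phi>: "\<And>i. i \<in> I \<Longrightarrow> convex_on UNIV (\<phi> i)"
    "\<And>i x. i \<in> I \<Longrightarrow> p x \<le> \<phi> i x"
    "\<And>x r. p x < r \<Longrightarrow> \<exists>i\<in>I. \<phi> i x < r"
    using real_sup_family[OF fin p] by metis
  have "{x. p x < r} = (\<Union>i\<in>I. {x. \<phi> i x < r})"
    using \<phi>(2,3) by (fastforce intro: le_less_trans)
  moreover have "open {x. \<phi> i x < r}" if "i \<in> I" for i
    using convex_on_continuous[OF open_UNIV \<phi>(1)[OF that]]
    by (intro open_Collect_less) auto
  ultimately show ?thesis by auto
qed

lemma inf_sup_positively_homogeneous:
  fixes p :: "'a::euclidean_space \<Rightarrow> real" and a :: "'i \<Rightarrow> 's \<Rightarrow> 'a"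
  assumes fin: "\<And>x i. i \<in> I \<Longrightarrow> (SUP s\<in>S. ereal (a i s \<bullet> x)) < \<infinity>"
    and p: "\<And>x. ereal (p x) = (INF i\<in>I. SUP s\<in>S. ereal (a i s \<bullet> x))"
  shows "positively_homogeneous p"
proof -
  obtain \<phi> where \<phi>: "\<And>i c x. i \<in> I \<Longrightarrow> 0 < c \<Longrightarrow> \<phi> i (c *\<^sub>R x) \<le> c * \<phi> i x"
    "\<And>i x. i \<in> I \<Longrightarrow> p x \<le> \<phi> i x"
    "\<And>x r. p x < r \<Longrightarrow> \<exists>i\<in>I. \<phi> i x < r"
    using real_sup_family[OF fin p] by metis
  have le: "p (c *\<^sub>R x) \<le> c * p x" if c: "0 < c" for c x
  proof -
    have "p (c *\<^sub>R x) / c \<le> r" if r: "p x < r" for r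
    proof -
      obtain i where i: "i \<in> I" "\<phi> i x < r" using \<phi>(3)[OF r] by blast
      have "p (c *\<^sub>R x) \<le> c * \<phi> i x"
        using \<phi>(1)[OF i(1) c, of x] \<phi>(2)[OF i(1), of "c *\<^sub>R x"] by linarith
      also have "\<dots> \<le> c * r" using i c by simp
      finally show ?thesis using c by (simp add: field_simps)
    qed
    then have "p (c *\<^sub>R x) / c \<le> p x" by (rule dense_ge)
    then show ?thesis using c by (simp add: field_simps)
  qed
  \<comment> \<open>Applied to \<open>1 / c\<close> and \<open>c *\<^sub>R x\<close>, the inequality yields its own converse.\<close>
  have "p (c *\<^sub>R x) = c * p x" if c: "0 < c" for c x
    using le[OF c, of x] le[of "1 / c" "c *\<^sub>R x"] c by (simp add: field_simps)
  then show ?thesis by (simp add: positively_homogeneous_def)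
qed

text \<open>Negation exchanges the two iterated bounds; both halves of continuity thus come from
  a single semicontinuity statement.\<close>

lemma inf_sup_representation_uminus:
  assumes "inf_sup_representation p I S a"
  shows "inf_sup_representation (\<lambda>x. - p x) S I (\<lambda>s i. - a i s)"
proof -
  have e: "ereal (- r) = - ereal r" for r by simp
  show ?thesis
    using assms
    unfolding inf_sup_representation_def inner_minus_left e ereal_INF_uminus_eq ereal_SUP_uminus_eq
    by (intro conjI allI ballI)
      (simp_all add: ereal_less_uminus_reorder ereal_uminus_less_reorder ereal_uminus_eq_reorder,
        metis)
qed

lemma inf_sup_representation_sufficient:
  assumes "inf_sup_representation p I S a"
  shows "positively_homogeneous p \<and> continuous_on UNIV p"
proof
  note neg = inf_sup_representation_uminus[OF assms]
  show "positively_homogeneous p"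
    using assms unfolding inf_sup_representation_def
    by (intro inf_sup_positively_homogeneous[where I = I and S = S and a = a]) auto
  have less: "open {x. p x < r}" for r
    using assms unfolding inf_sup_representation_def
    by (intro inf_sup_open_sublevel[where I = I and S = S and a = a]) auto
  have greater: "open {x. r < p x}" for r
  proof -
    have "open {x. - p x < - r}"
      using neg unfolding inf_sup_representation_def
      by (intro inf_sup_open_sublevel[where I = S and S = I and a = "\<lambda>s i. - a i s"]) auto
    then show ?thesis by simp
  qed
  show "continuous_on UNIV p"
    unfolding continuous_on_def
  proof (intro ballI order_tendstoI)
    fix x r
    show "eventually (\<lambda>y. r < p y) (at x)" if "r < p x"
      using eventually_at_in_open'[OF greater[of r], of x] that by simp
    show "eventually (\<lambda>y. p y < r) (at x)" if "p x < r"
      using eventually_at_in_open'[OF less[of r], of x] that by simp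
  qed
qed

section \<open>Conical majorants\<close>

definition conical_majorants :: "('a::real_inner \<Rightarrow> real) \<Rightarrow> ('a \<Rightarrow> real) set" where
  "conical_majorants p =
     {\<phi>. (\<exists>b C. 0 \<le> C \<and> \<phi> = (\<lambda>x. b \<bullet> x + C * norm x)) \<and> (\<forall>x. p x \<le> \<phi> x)}"

text \<open>Since \<open>- \<psi> \<le> \<phi>\<close>, the distance from \<open>b\<close> to \<open>- d\<close> is at most \<open>C + D\<close>, so the balls of radii \<open>C\<close>
  and \<open>D\<close> about these two centres share the point dividing the segment in the ratio \<open>C : D\<close>.\<close>

lemma linear_between_cones:
  fixes b d :: "'a::real_inner"
  assumes CD: "0 \<le> C" "0 \<le> D"
    and le: "\<And>x. - (d \<bullet> x + D * norm x) \<le> b \<bullet> x + C * norm x"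
  obtains v where "\<And>x. - (d \<bullet> x + D * norm x) \<le> v \<bullet> x" "\<And>x. v \<bullet> x \<le> b \<bullet> x + C * norm x"
proof -
  define w where "w = - d - b"
  have "w \<bullet> w \<le> (C + D) * norm w"
    using le[of w] by (simp add: w_def inner_diff_left algebra_simps)
  then have "norm w * norm w \<le> (C + D) * norm w"
    by (simp add: power2_norm_eq_inner flip: power2_eq_square)
  then have w: "norm w \<le> C + D"
    using CD by (cases "w = 0") auto
  \<comment> \<open>If \<open>C + D = 0\<close>, the two centres coincide and the value \<open>0\<close> of the quotient is harmless.\<close>
  define t where "t = C / (C + D)"
  have t: "0 \<le> t" "t \<le> 1" "t * norm w \<le> C" "(1 - t) * norm w \<le> D"
  proof -
    show "0 \<le> t" "t \<le> 1" using CD by (auto simp: t_def divide_le_eq_1)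
    then have "t * norm w \<le> t * (C + D)" "(1 - t) * norm w \<le> (1 - t) * (C + D)"
      using w by (auto intro: mult_left_mono)
    moreover have "t * (C + D) = C" using CD by (cases "C + D = 0") (auto simp: t_def)
    ultimately show "t * norm w \<le> C" "(1 - t) * norm w \<le> D"
      by (auto simp: algebra_simps)
  qed
  have cs: "r * \<bar>w \<bullet> x\<bar> \<le> E * norm x" if "0 \<le> r" "r * norm w \<le> E" for r E x
  proof -
    have "r * \<bar>w \<bullet> x\<bar> \<le> r * (norm w * norm x)"
      using that Cauchy_Schwarz_ineq2 by (intro mult_left_mono)
    also have "\<dots> \<le> E * norm x"
      using mult_right_mono[OF that(2) norm_ge_zero[of x]] by (simp add: mult.assoc)
    finally show ?thesis .
  qed
  show thesis
  proof (rule that[of "b + t *\<^sub>R w"])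
    fix x
    have "t * (w \<bullet> x) \<le> t * \<bar>w \<bullet> x\<bar>" using t by (intro mult_left_mono) auto
    then show "(b + t *\<^sub>R w) \<bullet> x \<le> b \<bullet> x + C * norm x"
      using cs[OF t(1,3), of x] by (simp add: inner_add_left)
    have "(1 - t) * (w \<bullet> x) \<le> (1 - t) * \<bar>w \<bullet> x\<bar>" using t by (intro mult_left_mono) auto
    moreover have "(b + t *\<^sub>R w) \<bullet> x = - (d \<bullet> x) - (1 - t) * (w \<bullet> x)"
      by (simp add: w_def inner_add_left inner_diff_left algebra_simps)
    ultimately show "- (d \<bullet> x + D * norm x) \<le> (b + t *\<^sub>R w) \<bullet> x"
      using cs[of "1 - t" D x] t by linarith
  qed
qed

lemma positively_homogeneous_zero:
  assumes "positively_homogeneous p"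
  shows "p 0 = 0"
proof -
  have "p (2 *\<^sub>R 0) = 2 * p 0"
    using assms unfolding positively_homogeneous_def by (metis zero_less_numeral)
  then show ?thesis unfolding scaleR_zero_right by linarith
qed

lemma positively_homogeneous_leI:
  fixes p q :: "'a::real_normed_vector \<Rightarrow> real"
  assumes p: "positively_homogeneous p" and q: "positively_homogeneous q"
    and le: "\<And>y. norm y = 1 \<Longrightarrow> p y \<le> q y"
  shows "p x \<le> q x"
proof (cases "x = 0")
  case True
  then show ?thesis using p q by (simp add: positively_homogeneous_zero)
next
  case False
  define y where "y = (1 / norm x) *\<^sub>R x"
  have "p (norm x *\<^sub>R y) = norm x * p y" "q (norm x *\<^sub>R y) = norm x * q y"
    using p q False unfolding positively_homogeneous_def by auto
  moreover have "norm x *\<^sub>R y = x" "norm y = 1" using False by (auto simp: y_def)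
  ultimately show ?thesis using le[of y] by (simp add: mult_left_mono)
qed

lemma positively_homogeneous_cone:
  "positively_homogeneous (\<lambda>x. b \<bullet> x + C * norm x)"
proof -
  have "b \<bullet> (c *\<^sub>R x) + C * norm (c *\<^sub>R x) = c * (b \<bullet> x + C * norm x)" if "0 < c" for c x
  proof -
    have "norm (c *\<^sub>R x) = c * norm x" using that by simp
    then show ?thesis unfolding inner_scaleR_right by algebra
  qed
  then show ?thesis by (simp add: positively_homogeneous_def)
qed

text \<open>Let \<open>m\<close> be slightly larger than \<open>p u\<close>. On the unit sphere the linear function with value \<open>m\<close> at
  \<open>u\<close> exceeds \<open>p\<close> near \<open>u\<close> by continuity. The correction \<open>norm x - u \<bullet> x\<close> is nonnegative, vanishes at
  \<open>u\<close>, and is bounded away from zero on the remainder of the sphere, where a large multiple of it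
  outweighs the bounded function \<open>p\<close>.\<close>

lemma conical_majorant_at_unit_vector:
  fixes p :: "'a::euclidean_space \<Rightarrow> real"
  assumes ph: "positively_homogeneous p" and cont: "continuous_on UNIV p"
    and u: "norm u = 1" and e: "0 < e"
  shows "\<exists>\<phi>\<in>conical_majorants p. \<phi> u \<le> p u + e"
proof -
  have "compact (p ` sphere 0 1)"
    using cont by (intro compact_continuous_image) (auto intro: continuous_on_subset)
  then obtain K where K: "\<And>y. norm y = 1 \<Longrightarrow> \<bar>p y\<bar> \<le> K"
    by (force dest: compact_imp_bounded simp: bounded_iff)
  define m where "m = p u + e"
  have "open {y. p y < m * (u \<bullet> y)}"
    by (intro open_Collect_less cont continuous_intros)
  moreover have uu: "u \<bullet> u = 1" using u by (simp add: norm_eq_1)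
  ultimately obtain \<delta> where \<delta>: "0 < \<delta>" "\<And>y. dist y u < \<delta> \<Longrightarrow> p y < m * (u \<bullet> y)"
    using e unfolding open_dist by (force simp: m_def)
  \<comment> \<open>Unit vectors satisfy \<open>1 - u \<bullet> y = (dist y u)\<^sup>2 / 2\<close>, so \<open>C * (1 - u \<bullet> y) \<ge> K + \<bar>m\<bar>\<close> at distance at
    least \<open>\<delta>\<close> from \<open>u\<close>.\<close>
  define C where "C = 2 * (K + \<bar>m\<bar>) / \<delta>\<^sup>2"
  have Km: "0 \<le> K + \<bar>m\<bar>" using K[OF u] by linarith
  then have C: "0 \<le> C" by (simp add: C_def)
  define \<phi> where "\<phi> = (\<lambda>y. ((m - C) *\<^sub>R u) \<bullet> y + C * norm y)"
  have unit: "p y \<le> \<phi> y" if y: "norm y = 1" for y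
  proof -
    have \<phi>: "\<phi> y = m * (u \<bullet> y) + C * (1 - u \<bullet> y)"
      using y by (simp add: \<phi>_def algebra_simps)
    have uy: "\<bar>u \<bullet> y\<bar> \<le> 1" using Cauchy_Schwarz_ineq2[of u y] u y by simp
    show ?thesis
    proof (cases "dist y u < \<delta>")
      case True
      then have "p y < m * (u \<bullet> y)" by (rule \<delta>)
      moreover have "0 \<le> C * (1 - u \<bullet> y)" using C uy by (intro mult_nonneg_nonneg) auto
      ultimately show ?thesis using \<phi> by linarith
    next
      case False
      have "(dist y u)\<^sup>2 = 2 * (1 - u \<bullet> y)"
        using y uu by (simp add: dist_norm power2_norm_eq_inner norm_eq_1 inner_diff_left
            inner_diff_right inner_commute)
      moreover have "\<delta>\<^sup>2 \<le> (dist y u)\<^sup>2" using False \<delta>(1) by (intro power_mono) auto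
      ultimately have "C * (\<delta>\<^sup>2 / 2) \<le> C * (1 - u \<bullet> y)" using C by (intro mult_left_mono) auto
      then have "K + \<bar>m\<bar> \<le> C * (1 - u \<bullet> y)" using \<delta>(1) by (simp add: C_def)
      moreover have "\<bar>m * (u \<bullet> y)\<bar> \<le> \<bar>m\<bar>"
        using mult_left_mono[OF uy, of "\<bar>m\<bar>"] by (simp add: abs_mult)
      ultimately show ?thesis using \<phi> K[OF y] by linarith
    qed
  qed
  have "p y \<le> \<phi> y" for y
    using positively_homogeneous_leI[OF ph _ unit] unfolding \<phi>_def
    by (simp add: positively_homogeneous_cone del: inner_scaleR_left)
  then have "\<phi> \<in> conical_majorants p"
    using C unfolding conical_majorants_def \<phi>_def by blast
  moreover have "\<phi> u = p u + e" using u uu by (simp add: \<phi>_def m_def algebra_simps)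
  ultimately show ?thesis by (intro bexI[of _ \<phi>]) auto
qed

lemma conical_majorant_exists:
  fixes p :: "'a::euclidean_space \<Rightarrow> real"
  assumes ph: "positively_homogeneous p" and cont: "continuous_on UNIV p" and e: "0 < e"
  shows "\<exists>\<phi>\<in>conical_majorants p. \<phi> x \<le> p x + e"
proof (cases "x = 0")
  case True
  \<comment> \<open>All conical functions vanish at the origin, so any majorant at all will do.\<close>
  obtain u :: 'a where "norm u = 1" using vector_choose_size[of 1] by auto
  then obtain \<phi> where "\<phi> \<in> conical_majorants p"
    using conical_majorant_at_unit_vector[OF ph cont _ e] by blast
  moreover from this have "\<phi> 0 = 0" by (auto simp: conical_majorants_def)
  ultimately show ?thesis
    using True e by (auto simp: positively_homogeneous_zero[OF ph] intro!: bexI[of _ \<phi>])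
next
  case False
  define u where "u = (1 / norm x) *\<^sub>R x"
  have x: "x = norm x *\<^sub>R u" and "norm u = 1" using False by (auto simp: u_def)
  then obtain \<phi> where \<phi>: "\<phi> \<in> conical_majorants p" "\<phi> u \<le> p u + e / norm x"
    using conical_majorant_at_unit_vector[OF ph cont, of u "e / norm x"] e False by auto
  have "positively_homogeneous \<phi>"
    using \<phi>(1) positively_homogeneous_cone by (auto simp: conical_majorants_def)
  then have "\<phi> x = norm x * \<phi> u" "p x = norm x * p u"
    using ph False x unfolding positively_homogeneous_def by (metis zero_less_norm_iff)+
  moreover have "norm x * \<phi> u \<le> norm x * (p u + e / norm x)"
    using \<phi>(2) by (intro mult_left_mono) auto
  ultimately have "\<phi> x \<le> p x + e" using False by (simp add: algebra_simps)
  then show ?thesis using \<phi>(1) by blast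
qed

section \<open>The two-index family\<close>

text \<open>The second index set consists of the majorants of \<open>- p\<close>, that is, of the negated minorants of
  \<open>p\<close>; the approximation result then applies to both index sets in the same form.\<close>

lemma inf_sup_representation_necessary:
  fixes p :: "real ^ 'n \<Rightarrow> real"
  assumes ph: "positively_homogeneous p" and cont: "continuous_on UNIV p"
  shows "\<exists>a. inf_sup_representation p (conical_majorants p) (conical_majorants (\<lambda>x. - p x)) a"
proof -
  define I where "I = conical_majorants p"
  define S where "S = conical_majorants (\<lambda>x. - p x)"
  have "\<exists>v. \<forall>x. - \<psi> x \<le> v \<bullet> x \<and> v \<bullet> x \<le> \<phi> x" if "\<phi> \<in> I" "\<psi> \<in> S" for \<phi> \<psi>
  proof -
    from that obtain b C d D where
      "0 \<le> C" "\<phi> = (\<lambda>x. b \<bullet> x + C * norm x)" "0 \<le> D" "\<psi> = (\<lambda>x. d \<bullet> x + D * norm x)"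
      unfolding I_def S_def conical_majorants_def by blast
    moreover have "- \<psi> x \<le> \<phi> x" for x
    proof -
      have "p x \<le> \<phi> x" "- p x \<le> \<psi> x"
        using that unfolding I_def S_def conical_majorants_def by blast+
      then show ?thesis by linarith
    qed
    ultimately show ?thesis
      using linear_between_cones[of C D d b] by metis
  qed
  then obtain a where a: "\<And>\<phi> \<psi> x. \<phi> \<in> I \<Longrightarrow> \<psi> \<in> S \<Longrightarrow> - \<psi> x \<le> a \<phi> \<psi> \<bullet> x \<and> a \<phi> \<psi> \<bullet> x \<le> \<phi> x"
    by metis
  have inf_ge: "ereal (- \<psi> x) \<le> (INF \<phi>\<in>I. ereal (a \<phi> \<psi> \<bullet> x))" if "\<psi> \<in> S" for \<psi> x
    using a that by (intro INF_greatest) simp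
  have sup_le: "(SUP \<psi>\<in>S. ereal (a \<phi> \<psi> \<bullet> x)) \<le> ereal (\<phi> x)" if "\<phi> \<in> I" for \<phi> x
    using a that by (intro SUP_least) simp
  have inf_sup: "(INF \<phi>\<in>I. SUP \<psi>\<in>S. ereal (a \<phi> \<psi> \<bullet> x)) \<le> ereal (p x)" for x
  proof (rule ereal_le_epsilon2)
    fix e :: real assume "0 < e"
    then obtain \<phi> where \<phi>: "\<phi> \<in> I" "\<phi> x \<le> p x + e"
      using conical_majorant_exists[OF ph cont, of e x] unfolding I_def by blast
    have "(SUP \<psi>\<in>S. ereal (a \<phi> \<psi> \<bullet> x)) \<le> ereal (p x) + ereal e"
      using sup_le[OF \<phi>(1), of x] \<phi>(2) by (auto intro: order_trans)
    then show "(INF \<phi>\<in>I. SUP \<psi>\<in>S. ereal (a \<phi> \<psi> \<bullet> x)) \<le> ereal (p x) + ereal e"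
      by (rule INF_lower2[OF \<phi>(1)])
  qed
  have ph': "positively_homogeneous (\<lambda>x. - p x)"
    using ph by (simp add: positively_homogeneous_def)
  have cont': "continuous_on UNIV (\<lambda>x. - p x)"
    using cont by (intro continuous_intros)
  have sup_inf: "ereal (p x) \<le> (SUP \<psi>\<in>S. INF \<phi>\<in>I. ereal (a \<phi> \<psi> \<bullet> x))" for x
  proof (rule ereal_le_epsilon2)
    fix e :: real assume "0 < e"
    then obtain \<psi> where \<psi>: "\<psi> \<in> S" "\<psi> x \<le> - p x + e"
      using conical_majorant_exists[OF ph' cont', of e x] unfolding S_def by blast
    have "ereal (p x) \<le> ereal (- \<psi> x) + ereal e" using \<psi>(2) by simp
    also have "\<dots> \<le> (SUP \<psi>\<in>S. INF \<phi>\<in>I. ereal (a \<phi> \<psi> \<bullet> x)) + ereal e"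
      by (intro add_right_mono SUP_upper2[OF \<psi>(1)] inf_ge \<psi>(1))
    finally show "ereal (p x) \<le> (SUP \<psi>\<in>S. INF \<phi>\<in>I. ereal (a \<phi> \<psi> \<bullet> x)) + ereal e" .
  qed
  have minimax: "(SUP \<psi>\<in>S. INF \<phi>\<in>I. ereal (a \<phi> \<psi> \<bullet> x)) \<le> (INF \<phi>\<in>I. SUP \<psi>\<in>S. ereal (a \<phi> \<psi> \<bullet> x))"
    for x
  proof (intro SUP_least INF_greatest)
    fix \<phi> \<psi> assume \<phi>: "\<phi> \<in> I" and \<psi>: "\<psi> \<in> S"
    have "(INF \<phi>\<in>I. ereal (a \<phi> \<psi> \<bullet> x)) \<le> ereal (a \<phi> \<psi> \<bullet> x)" by (rule INF_lower[OF \<phi>])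
    also have "\<dots> \<le> (SUP \<psi>\<in>S. ereal (a \<phi> \<psi> \<bullet> x))" by (rule SUP_upper[OF \<psi>])
    finally show "(INF \<phi>\<in>I. ereal (a \<phi> \<psi> \<bullet> x)) \<le> (SUP \<psi>\<in>S. ereal (a \<phi> \<psi> \<bullet> x))" .
  qed
  have "- \<infinity> < (INF \<phi>\<in>I. ereal (a \<phi> \<psi> \<bullet> x))" if "\<psi> \<in> S" for \<psi> x
    by (rule less_le_trans[OF _ inf_ge[OF that]]) simp
  moreover have "(SUP \<psi>\<in>S. ereal (a \<phi> \<psi> \<bullet> x)) < \<infinity>" if "\<phi> \<in> I" for \<phi> x
    by (rule le_less_trans[OF sup_le[OF that]]) simp
  moreover have "ereal (p x) = (INF \<phi>\<in>I. SUP \<psi>\<in>S. ereal (a \<phi> \<psi> \<bullet> x))"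
    "ereal (p x) = (SUP \<psi>\<in>S. INF \<phi>\<in>I. ereal (a \<phi> \<psi> \<bullet> x))" for x
    using inf_sup[of x] sup_inf[of x] minimax[of x] by order+
  ultimately have "inf_sup_representation p I S a"
    unfolding inf_sup_representation_def by blast
  then show ?thesis unfolding I_def S_def by blast
qed

(* HOL cannot quantify existentially over types, so the index sets of the equivalence are drawn
   from the fixed type of real functions on R^n. The second conjunct restores full generality of
   the sufficiency direction: it covers index sets over arbitrary types 'i and 's. *)
theorem theorem1:
  fixes p :: "real ^ 'n \<Rightarrow> real"
  shows "((positively_homogeneous p \<and> continuous_on UNIV p) \<longleftrightarrow>
           (\<exists>(I :: (real ^ 'n \<Rightarrow> real) set) (S :: (real ^ 'n \<Rightarrow> real) set) a.
              inf_sup_representation p I S a)) \<and>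
         (\<forall>(I :: 'i set) (S :: 's set) a.
            inf_sup_representation p I S a \<longrightarrow>
              positively_homogeneous p \<and> continuous_on UNIV p)"
proof (intro conjI iffI allI impI)
  assume "positively_homogeneous p \<and> continuous_on UNIV p"
  then show "\<exists>(I :: (real ^ 'n \<Rightarrow> real) set) (S :: (real ^ 'n \<Rightarrow> real) set) a.
      inf_sup_representation p I S a"
    using inf_sup_representation_necessary by blast
qed (use inf_sup_representation_sufficient in blast)+

end
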